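(* Let $n$ be a positive integer. For every integer $t$ with $2 \le t \le n-2$: \begin{itemize} \item if $t \equiv 2 \pmod 4$ then $\Gamma_n^t$ is the one-element group $\{\iota_n\}$; \item if $t \equiv 3 \pmod 4$ then $\Gamma_n^t$ is the cyclic group $Z_n$; \item if $t \equiv 0 \pmod 4$ then $\Gamma_n^t$ is the two-element group $\{\rho_n, \iota_n\}$; \item if $t \equiv 1 \pmod 4$ then $\Gamma_n^t$ is the dihedral group $D_n$. \end{itemize}
   Context: $[n]=\{0,1,\dots,n-1\}$ with its usual order. $\iota_n$ is the identity on $[n]$; $\sigma_n$ is the cyclic shift $a\mapsto (a+1) \bmod n$; $\rho_n$ is the order-reversing permutation $a\mapsto (n-1)-a$. $Z_n$ is the group of permutations of $[n]$ generated by $\sigma_n$, and $D_n$ is the group generated by $\sigma_n$ and $\rho_n$. An inversion of a one-to-one partial mapping $\alpha$ on $[n]$ is a pair $a,b$ in its domain with $a<b$ and $\alpha(a)>\alpha(b)$; $\alpha$ is even if its number of inversions is even. For $2\le t\le n$, $\Gamma_n^t$ is the set (in fact, group under composition) of all permutations of $[n]$ whose restriction to every $t$-element subset of $[n]$ is even. *)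

theory Defs
  imports
    "HOL-Combinatorics.Permutations"
    "HOL-Algebra.Generated_Groups"
    "HOL-Number_Theory.Cong"
begin

text \<open>
  Permutations of \<open>[n] = {..<n}\<close> are functions on \<^typ>\<open>nat\<close> that fix every number
  outside \<open>{..<n}\<close>, as in \<^const>\<open>permutes\<close>; the identity permutation of \<open>[n]\<close> is thus
  \<^term>\<open>id :: nat \<Rightarrow> nat\<close>.
\<close>

definition perm_group :: "nat \<Rightarrow> (nat \<Rightarrow> nat) monoid" where
  "perm_group n = \<lparr>carrier = {p. p permutes {..<n}}, mult = (\<circ>), one = id\<rparr>"

definition cyclic_shift :: "nat \<Rightarrow> nat \<Rightarrow> nat" where
  "cyclic_shift n a = (if a < n then (a + 1) mod n else a)"

definition order_reversal :: "nat \<Rightarrow> nat \<Rightarrow> nat" where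
  "order_reversal n a = (if a < n then (n - 1) - a else a)"

definition cyclic_perms :: "nat \<Rightarrow> (nat \<Rightarrow> nat) set" where
  "cyclic_perms n = generate (perm_group n) {cyclic_shift n}"

definition dihedral_perms :: "nat \<Rightarrow> (nat \<Rightarrow> nat) set" where
  "dihedral_perms n = generate (perm_group n) {cyclic_shift n, order_reversal n}"

text \<open>
  A partial mapping is represented by its domain \<open>A\<close> and a total function \<open>f\<close>, of which only
  the values on \<open>A\<close> matter; the restriction of \<open>f\<close> to \<open>T\<close> is then given by \<open>T\<close> and \<open>f\<close>.
  In contrast to \<^const>\<open>evenperm\<close>, \<open>f\<close> need not map \<open>A\<close> to itself.
\<close>

definition inversions_on :: "nat set \<Rightarrow> (nat \<Rightarrow> nat) \<Rightarrow> (nat \<times> nat) set" where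
  "inversions_on A f = {(a, b). a \<in> A \<and> b \<in> A \<and> a < b \<and> f a > f b}"

definition even_on :: "nat set \<Rightarrow> (nat \<Rightarrow> nat) \<Rightarrow> bool" where
  "even_on A f \<longleftrightarrow> even (card (inversions_on A f))"

definition Gamma :: "nat \<Rightarrow> nat \<Rightarrow> (nat \<Rightarrow> nat) set" where
  "Gamma n t = {p. p permutes {..<n} \<and> (\<forall>T. T \<subseteq> {..<n} \<and> card T = t \<longrightarrow> even_on T p)}"

lemma group_perm_group: "group (perm_group n)"
proof (rule groupI)
  fix x assume "x \<in> carrier (perm_group n)"
  then show "\<exists>y\<in>carrier (perm_group n). y \<otimes>\<^bsub>perm_group n\<^esub> x = \<one>\<^bsub>perm_group n\<^esub>"
    by (auto simp: perm_group_def intro!: exI[of _ "inv_into UNIV x"] permutes_inv permutes_inv_o)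
qed (auto simp: perm_group_def permutes_compose permutes_id comp_assoc)

lemma cyclic_shift_permutes: "cyclic_shift n permutes {..<n}"
proof (rule bij_imp_permutes)
  have "inj_on (cyclic_shift n) {..<n}"
    by (auto simp: inj_on_def cyclic_shift_def mod_Suc split: if_splits)
  moreover have "cyclic_shift n ` {..<n} \<subseteq> {..<n}"
    by (auto simp: cyclic_shift_def)
  ultimately show "bij_betw (cyclic_shift n) {..<n} {..<n}"
    by (simp add: bij_betw_def endo_inj_surj)
qed (simp add: cyclic_shift_def)

lemma order_reversal_permutes: "order_reversal n permutes {..<n}"
  by (rule bij_imp_permutes)
    (auto simp: order_reversal_def intro!: bij_betw_byWitness[where f' = "order_reversal n"])

end

theory Submission
  imports Defs "HOL-Combinatorics.Cycles"
begin

text \<open>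
  Join \<open>a\<close> and \<open>b\<close> by an edge when the permutation \<open>p\<close> inverts them; membership of \<open>p\<close> in
  \<^term>\<open>Gamma n t\<close> says that every \<open>t\<close>-set of vertices spans an even number of edges.  Fix \<open>t - 2\<close> vertices and four further ones
  \<open>a, b, c, d\<close>, which exist since \<open>t + 2 \<le> n\<close>, and add the edge counts of the four \<open>t\<close>-sets
  obtained by adjoining one of \<open>a, b\<close> and one of \<open>c, d\<close>: modulo 2 only the four-cycle
  \<open>a c b d\<close> survives.  So all four-cycles have an even number of edges, hence all
  triangles have the same parity \<open>k\<close>, and this forces the edge indicator to have the form
  \<open>x a + x b + k\<close> modulo 2 for some \<open>x\<close> (lemma \<open>Gamma_cut_inversions\<close>).

  For such a permutation a set \<open>T\<close> with \<open>t\<close> elements, \<open>u\<close> of which have \<open>x = 1\<close>, spans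
  \<open>(t - 1) * u + (t choose 2) * k\<close> edges modulo 2 (lemma \<open>even_on_cut\<close>).  If \<open>t\<close> is
  even, then the parity of \<open>u\<close> is the same for all \<open>t\<close>-sets, so \<open>x\<close> is constant, the
  graph is empty or complete, and \<open>p\<close> is the identity or the reversal.  If \<open>t\<close> is odd, then \<open>x\<close> is
  unconstrained.  In either case \<open>k = 1\<close> is possible exactly when \<open>t choose 2\<close> is even.

  Finally, inversion indicators obey the cocycle rule \<open>inverted_comp\<close>, so that the permutations
  with \<open>k = 0\<close> form a group containing \<open>\<sigma>\<close>.  It is no larger than \<open>Z\<^sub>n\<close>: after
  composition with a power of \<open>\<sigma>\<close> such a permutation fixes \<open>0\<close>; then \<open>0\<close> is an
  isolated vertex, \<open>x\<close> is constant, and the permutation is increasing.  The reversal has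
  \<open>k = 1\<close>, so composing with it reduces \<open>k = 1\<close> to \<open>k = 0\<close>, which yields the dihedral group.
\<close>

section \<open>The inversion graph of a permutation\<close>

definition inverted :: "(nat \<Rightarrow> nat) \<Rightarrow> nat \<Rightarrow> nat \<Rightarrow> bool" where
  "inverted p a b \<longleftrightarrow> (a < b) \<noteq> (p a < p b)"

text \<open>
  Modulo 2 the equation reads \<open>x a + x b + k\<close>.  So the inversion graph on \<open>{..<n}\<close> is the complete
  bipartite graph of a cut if \<open>k\<close> is \<^const>\<open>False\<close>, and the complement of one otherwise.
\<close>

definition cut_with :: "nat \<Rightarrow> (nat \<Rightarrow> bool) \<Rightarrow> bool \<Rightarrow> (nat \<Rightarrow> nat) \<Rightarrow> bool" where
  "cut_with n x k p \<longleftrightarrow> (\<forall>a<n. \<forall>b<n. a \<noteq> b \<longrightarrow> inverted p a b = (x a \<noteq> (x b \<noteq> k)))"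

lemma inverted_commute: "p a \<noteq> p b \<Longrightarrow> a \<noteq> b \<Longrightarrow> inverted p a b = inverted p b a"
  unfolding inverted_def by auto

text \<open>A pair whose order is reversed by \<open>q\<close> and again by \<open>p\<close> ends in its original order.\<close>

lemma inverted_comp: "inverted (p \<circ> q) a b = (inverted q a b \<noteq> inverted p (q a) (q b))"
  unfolding inverted_def by auto

lemma card_inversions_insert:
  assumes "finite T" "a \<notin> T" "inj_on p (insert a T)"
  shows "card (inversions_on (insert a T) p)
    = card (inversions_on T p) + card {b \<in> T. inverted p a b}"
proof -
  let ?g = "\<lambda>b. (min a b, max a b)"
  have eq: "inversions_on (insert a T) p = inversions_on T p \<union> ?g ` {b \<in> T. inverted p a b}"
  proof (rule equalityI; rule subrelI; (rule UnCI)?)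
    fix c d assume cd: "(c, d) \<in> inversions_on (insert a T) p"
      "(c, d) \<notin> ?g ` {b \<in> T. inverted p a b}"
    have "c \<noteq> a"
    proof
      assume "c = a"
      then have "(c, d) = ?g d" "d \<in> T" "inverted p a d"
        using cd(1) by (auto simp: inversions_on_def inverted_def min_def max_def)
      then show False using cd(2) by blast
    qed
    moreover have "d \<noteq> a"
    proof
      assume "d = a"
      then have "(c, d) = ?g c" "c \<in> T" "inverted p a c"
        using cd(1) by (auto simp: inversions_on_def inverted_def min_def max_def)
      then show False using cd(2) by blast
    qed
    ultimately show "(c, d) \<in> inversions_on T p"
      using cd(1) by (auto simp: inversions_on_def)
  next
    fix c d assume "(c, d) \<in> inversions_on T p \<union> ?g ` {b \<in> T. inverted p a b}"
    moreover have "p a \<noteq> p b" if "b \<in> T" for b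
      using assms(2,3) that by (auto simp: inj_on_def)
    ultimately show "(c, d) \<in> inversions_on (insert a T) p"
      using assms(2)
      by (force simp: inversions_on_def inverted_def min_def max_def split: if_splits)
  qed
  have "finite (inversions_on T p)"
    by (rule finite_subset[of _ "T \<times> T"]) (auto simp: inversions_on_def assms(1))
  moreover have "inj_on ?g {b \<in> T. inverted p a b}"
    by (auto simp: inj_on_def min_def max_def split: if_splits)
  moreover have "inversions_on T p \<inter> ?g ` {b \<in> T. inverted p a b} = {}"
    using assms(2) by (auto simp: inversions_on_def min_def max_def split: if_splits)
  ultimately show ?thesis
    unfolding eq using assms(1) by (simp add: card_Un_disjoint card_image)
qed

lemma even_on_insert:
  assumes "finite T" "a \<notin> T" "inj_on p (insert a T)"
  shows "even_on (insert a T) p = (even_on T p = even (card {b \<in> T. inverted p a b}))"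
  unfolding even_on_def card_inversions_insert[OF assms] by simp

lemma even_on_insert2:
  assumes "finite S" "a \<notin> S" "c \<notin> S" "a \<noteq> c" "inj_on p (insert a (insert c S))"
  shows "even_on (insert a (insert c S)) p
    \<longleftrightarrow> (even_on S p = (even (card {b \<in> S. inverted p a b}) =
         (even (card {b \<in> S. inverted p c b}) = (\<not> inverted p a c))))"
proof -
  have "{b \<in> insert c S. inverted p a b} =
      (if inverted p a c then insert c {b \<in> S. inverted p a b} else {b \<in> S. inverted p a b})"
    by auto
  then have "even (card {b \<in> insert c S. inverted p a b})
      = (even (card {b \<in> S. inverted p a b}) = (\<not> inverted p a c))"
    using assms by auto
  moreover have "even_on (insert a (insert c S)) p
      = (even_on (insert c S) p = even (card {b \<in> insert c S. inverted p a b}))"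
    using assms by (intro even_on_insert) auto
  moreover have "even_on (insert c S) p = (even_on S p = even (card {b \<in> S. inverted p c b}))"
    using assms by (intro even_on_insert) (auto simp: inj_on_def)
  ultimately show ?thesis by auto
qed

section \<open>Graphs whose four-cycles are even\<close>

text \<open>
  Two triangles with a common side differ by a four-cycle, so all triangles have the same parity
  \<open>k\<close>; the triangles through \<open>0\<close> then express every edge by the edges at \<open>0\<close>.
\<close>

lemma even_four_cycles_imp_cut:
  fixes e :: "nat \<Rightarrow> nat \<Rightarrow> bool"
  assumes n: "n \<ge> 3"
    and sym: "\<And>a b. a < n \<Longrightarrow> b < n \<Longrightarrow> a \<noteq> b \<Longrightarrow> e a b = e b a"
    and cyc: "\<And>a b c d. a < n \<Longrightarrow> b < n \<Longrightarrow> c < n \<Longrightarrow> d < n \<Longrightarrow> distinct [a, b, c, d]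
      \<Longrightarrow> (e a c \<noteq> e b c) = (e a d \<noteq> e b d)"
  shows "\<exists>x k. \<forall>a<n. \<forall>b<n. a \<noteq> b \<longrightarrow> e a b = (x a \<noteq> (x b \<noteq> k))"
proof -
  define tri where "tri a b = (e 0 a \<noteq> (e 0 b \<noteq> e a b))" for a b
  define k where "k = tri 1 2"
  define x where "x a = (a \<noteq> 0 \<and> e 0 a \<noteq> k)" for a
  have tri_sym: "tri a b = tri b a" if "a < n" "b < n" "a \<noteq> b" for a b
    using sym[OF that] by (auto simp: tri_def)
  have move: "tri a b = tri a c"
    if "a < n" "b < n" "c < n" "a \<noteq> 0" "b \<noteq> 0" "c \<noteq> 0" "a \<noteq> b" "a \<noteq> c" for a b c
  proof (cases "b = c")
    case False
    then show ?thesis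
      using cyc[of 0 a b c] that by (auto simp: tri_def)
  qed simp
  have tri: "tri a b = k" if ab: "a < n" "b < n" "a \<noteq> 0" "b \<noteq> 0" "a \<noteq> b" for a b
  proof (cases "a = 1")
    case True
    then show ?thesis using move[of 1 b 2] ab n by (auto simp: k_def)
  next
    case False
    have "tri a b = tri a 1" using move[of a b 1] ab n False by auto
    also have "\<dots> = tri 1 a" using tri_sym[of a 1] ab n False by auto
    also have "\<dots> = k" using move[of 1 a 2] ab n False by (auto simp: k_def)
    finally show ?thesis .
  qed
  have "e a b = (x a \<noteq> (x b \<noteq> k))" if ab: "a < n" "b < n" "a \<noteq> b" for a b
  proof (cases "a = 0 \<or> b = 0")
    case True
    then show ?thesis using ab sym[of a b] by (auto simp: x_def)
  next
    case False
    then show ?thesis using tri[of a b] ab by (auto simp: x_def tri_def)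
  qed
  then show ?thesis by (intro exI[of _ x] exI[of _ k]) simp
qed

lemma Gamma_cut_inversions:
  assumes "2 \<le> t" "t + 2 \<le> n" "p \<in> Gamma n t"
  obtains x k where "cut_with n x k p"
proof -
  have p: "p permutes {..<n}" and ev: "\<And>T. T \<subseteq> {..<n} \<Longrightarrow> card T = t \<Longrightarrow> even_on T p"
    using assms(3) by (auto simp: Gamma_def)
  have inj: "inj p" using permutes_inj[OF p] .
  have "\<exists>x k. \<forall>a<n. \<forall>b<n. a \<noteq> b \<longrightarrow> inverted p a b = (x a \<noteq> (x b \<noteq> k))"
  proof (rule even_four_cycles_imp_cut)
    show "3 \<le> n" using assms by simp
    show "inverted p a b = inverted p b a" if "a \<noteq> b" for a b
      using that inj by (intro inverted_commute) (auto simp: inj_eq)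
    fix a b c d assume lt: "a < n" "b < n" "c < n" "d < n" and dist: "distinct [a, b, c, d]"
    have "card ({..<n} - {a, b, c, d}) = n - 4"
      using lt dist by (subst card_Diff_subset) auto
    then have "t - 2 \<le> card ({..<n} - {a, b, c, d})"
      using assms by simp
    then obtain S where S: "S \<subseteq> {..<n} - {a, b, c, d}" "card S = t - 2" "finite S"
      by (rule obtain_subset_with_card_n)
    define N where "N u = even (card {v \<in> S. inverted p u v})" for u
    have *: "inverted p u w = (even_on S p \<noteq> (N u = N w))" if "u \<in> {a, b}" "w \<in> {c, d}" for u w
    proof -
      have uw: "u \<notin> S" "w \<notin> S" "u \<noteq> w" "u < n" "w < n"
        using that dist S lt by auto
      have "even_on (insert u (insert w S)) p"
        using uw S assms(1) by (intro ev) auto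
      then show ?thesis
        unfolding N_def even_on_insert2[OF S(3) uw(1,2,3) inj_on_subset[OF inj subset_UNIV]]
        by argo
    qed
    have "inverted p a c = (even_on S p \<noteq> (N a = N c))"
      "inverted p b c = (even_on S p \<noteq> (N b = N c))"
      "inverted p a d = (even_on S p \<noteq> (N a = N d))"
      "inverted p b d = (even_on S p \<noteq> (N b = N d))"
      by (rule *; simp)+
    then show "(inverted p a c \<noteq> inverted p b c) = (inverted p a d \<noteq> inverted p b d)"
      by argo
  qed
  then show ?thesis using that by (auto simp: cut_with_def)
qed

section \<open>Parity of the number of inversions\<close>

text \<open>
  When the vertices of \<open>T\<close> are added one by one, a new vertex \<open>a\<close> is joined to those earlier \<open>b\<close>
  with \<open>x a + x b + k = 1\<close>.  So \<open>x\<close> counts, for each vertex of \<open>T\<close>, once for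
  every other vertex, and \<open>k\<close> once for every pair.
\<close>

lemma even_on_cut:
  assumes "cut_with n x k p" "inj p" "T \<subseteq> {..<n}"
  shows "even_on T p \<longleftrightarrow>
    even ((card T - 1) * card {b \<in> T. x b} + (card T choose 2) * of_bool k)"
proof -
  have "finite T" using assms(3) finite_subset by blast
  then show ?thesis using assms(3)
  proof (induction T)
    case empty
    then show ?case by (simp add: even_on_def inversions_on_def binomial_eq_0)
  next
    case (insert a T)
    define u where "u = card {b \<in> T. x b}"
    define v where "v = card {b \<in> T. \<not> x b}"
    have "card T = card ({b \<in> T. x b} \<union> {b \<in> T. \<not> x b})"
      by (rule arg_cong[where f = card]) auto
    also have "\<dots> = u + v"
      unfolding u_def v_def using insert(1) by (intro card_Un_disjoint) auto
    finally have uv: "card T = u + v" .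
    have "{b \<in> T. inverted p a b} = {b \<in> T. x a \<noteq> (x b \<noteq> k)}"
      using assms(1) insert(2,4) by (auto simp: cut_with_def)
    also have "card \<dots> = (if x a = k then u else v)"
      by (cases "x a"; cases k) (simp_all add: u_def v_def)
    finally have nb: "even (card {b \<in> T. inverted p a b})
        = (even u = (x a \<noteq> k \<longrightarrow> even (card T)))"
      by (auto simp: uv)
    have u': "card {b \<in> insert a T. x b} = u + of_bool (x a)"
    proof -
      have "{b \<in> insert a T. x b} = (if x a then insert a {b \<in> T. x b} else {b \<in> T. x b})"
        by auto
      then show ?thesis using insert(1,2) by (auto simp: u_def)
    qed
    have "even_on T p \<longleftrightarrow> even ((card T - 1) * u + (card T choose 2) * of_bool k)"
      using insert by (simp add: u_def)
    moreover have "even ((card T - 1) * u) \<longleftrightarrow> even u \<or> odd (card T)"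
    proof (cases "card T")
      case 0
      then show ?thesis using insert(1) by (simp add: u_def)
    qed auto
    ultimately have IH': "even_on T p \<longleftrightarrow>
        ((even u \<or> odd (card T)) \<longleftrightarrow> even ((card T choose 2) * of_bool k))"
      by simp
    have choose: "card (insert a T) choose 2 = card T + (card T choose 2)"
      using insert(1,2) by (simp add: numeral_2_eq_2)
    have card: "card (insert a T) - 1 = card T"
      using insert(1,2) by simp
    have "even_on (insert a T) p = (even_on T p = even (card {b \<in> T. inverted p a b}))"
      using insert(1,2) assms(2) by (intro even_on_insert inj_on_subset[OF assms(2) subset_UNIV])
    then show ?case
      unfolding nb IH' u' choose card by (cases "x a"; cases k) auto
  qed
qed

lemma even_choose_two_iff: "even (t choose 2) \<longleftrightarrow> t mod 4 = 0 \<or> t mod 4 = 1"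
proof -
  define q r where "q = t div 4" and "r = t mod 4"
  have t: "t = 4 * q + r" by (simp add: q_def r_def)
  have "r < 4" by (simp add: r_def)
  then consider "r = 0" | "r = 1" | "r = 2" | "r = 3" by linarith
  then have "even (t choose 2) \<longleftrightarrow> r = 0 \<or> r = 1"
  proof cases
    case 1
    then have "t choose 2 = 2 * (q * (t - 1))" by (simp add: choose_two t)
    then show ?thesis using 1 by simp
  next
    case 2
    then have "t choose 2 = 2 * (q * t)" by (simp add: choose_two t)
    then show ?thesis using 2 by simp
  next
    case 3
    then have "t choose 2 = (2 * q + 1) * (4 * q + 1)" by (simp add: choose_two t)
    then show ?thesis using 3 by simp
  next
    case 4
    then have "t * (t - 1) = 2 * ((4 * q + 3) * (2 * q + 1))" by (simp add: t algebra_simps)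
    then have "t choose 2 = (4 * q + 3) * (2 * q + 1)" by (simp add: choose_two)
    then show ?thesis using 4 by simp
  qed
  then show ?thesis by (simp add: r_def)
qed

lemma Gamma_of_cut:
  assumes "cut_with n x k p" "p permutes {..<n}"
    and "\<And>T. T \<subseteq> {..<n} \<Longrightarrow> card T = t
      \<Longrightarrow> even ((t - 1) * card {b \<in> T. x b} + (t choose 2) * of_bool k)"
  shows "p \<in> Gamma n t"
  using assms even_on_cut[OF assms(1) permutes_inj[OF assms(2)]] by (auto simp: Gamma_def)

text \<open>
  A \<open>t\<close>-set containing \<open>a\<close> but not \<open>b\<close> exists since \<open>0 < t < n\<close>; exchanging \<open>a\<close> for
  \<open>b\<close> must not change the parity of the number of its elements with \<open>x = 1\<close>.
\<close>

lemma Gamma_even_cut_constant: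
  assumes "2 \<le> t" "t < n" "even t" "p \<in> Gamma n t" and cut: "cut_with n x k p"
    and ab: "a < n" "b < n"
  shows "x a = x b"
proof (cases "a = b")
  case False
  have p: "p permutes {..<n}" and ev: "\<And>T. T \<subseteq> {..<n} \<Longrightarrow> card T = t \<Longrightarrow> even_on T p"
    using assms(4) by (auto simp: Gamma_def)
  have "card ({..<n} - {a, b}) = n - 2"
    using ab False by (subst card_Diff_subset) auto
  then have "t - 1 \<le> card ({..<n} - {a, b})" using assms by simp
  then obtain S where S: "S \<subseteq> {..<n} - {a, b}" "card S = t - 1" "finite S"
    by (rule obtain_subset_with_card_n)
  have *: "even (card {v \<in> S. x v} + of_bool (x c)) = even ((t choose 2) * of_bool k)"
    if "c \<in> {a, b}" for c
  proof -
    have c: "c \<notin> S" "c < n" using S that ab by auto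
    have T: "insert c S \<subseteq> {..<n}" "card (insert c S) = t"
      using S c assms(1) by auto
    have "{v \<in> insert c S. x v} = (if x c then insert c {v \<in> S. x v} else {v \<in> S. x v})"
      by auto
    then have "card {v \<in> insert c S. x v} = card {v \<in> S. x v} + of_bool (x c)"
      using S c by auto
    then show ?thesis
      using even_on_cut[OF cut permutes_inj[OF p] T(1)] ev[OF T] T(2) assms(1,3) by auto
  qed
  show ?thesis using *[of a] *[of b] by (cases "x a"; cases "x b") auto
qed simp

text \<open>
  For odd \<open>t\<close> the coefficient \<open>t - 1\<close> is even, and for even \<open>t\<close> the number of elements with
  \<open>x = 1\<close> is \<open>0\<close> or \<open>t\<close>; either way only the second term remains.
\<close>

lemma Gamma_cut_complement_even_choose:
  assumes "2 \<le> t" "t < n" "p \<in> Gamma n t" and cut: "cut_with n x True p"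
  shows "even (t choose 2)"
proof -
  have p: "p permutes {..<n}" and ev: "\<And>T. T \<subseteq> {..<n} \<Longrightarrow> card T = t \<Longrightarrow> even_on T p"
    using assms(3) by (auto simp: Gamma_def)
  have T: "{..<t} \<subseteq> {..<n}" "card {..<t} = t" using assms by auto
  have *: "even ((t - 1) * card {b \<in> {..<t}. x b} + (t choose 2))"
    using even_on_cut[OF cut permutes_inj[OF p] T(1)] ev[OF T] T(2) by auto
  show ?thesis
  proof (cases "even t")
    case True
    have "x b = x 0" if "b < t" for b
      using Gamma_even_cut_constant[OF assms(1,2) True assms(3) cut, of b 0] that assms by auto
    then have "{b \<in> {..<t}. x b} = (if x 0 then {..<t} else {})" by auto
    then show ?thesis using * True by (auto split: if_splits)
  next
    case False
    then show ?thesis using * by auto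
  qed
qed

section \<open>Permutations whose inversions form a cut\<close>

lemma cut_with_comp:
  assumes "cut_with n x k p" "cut_with n y l q" "q permutes {..<n}"
  shows "cut_with n (\<lambda>a. y a \<noteq> x (q a)) (k \<noteq> l) (p \<circ> q)"
  unfolding cut_with_def
proof (intro allI impI)
  fix a b assume ab: "a < n" "b < n" "a \<noteq> b"
  then have "q a < n" "q b < n" "q a \<noteq> q b"
    using permutes_in_image[OF assms(3)] permutes_inj[OF assms(3)] by (auto simp: inj_eq)
  then have "inverted p (q a) (q b) = (x (q a) \<noteq> (x (q b) \<noteq> k))"
    using assms(1) by (auto simp: cut_with_def)
  moreover have "inverted q a b = (y a \<noteq> (y b \<noteq> l))"
    using assms(2) ab by (auto simp: cut_with_def)
  ultimately show "inverted (p \<circ> q) a b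
      = ((y a \<noteq> x (q a)) \<noteq> ((y b \<noteq> x (q b)) \<noteq> (k \<noteq> l)))"
    unfolding inverted_comp by argo
qed

lemma cut_with_right_inverse:
  assumes "cut_with n x k p" "q permutes {..<n}" "p \<circ> q = id"
  shows "cut_with n (\<lambda>a. x (q a)) k q"
  unfolding cut_with_def
proof (intro allI impI)
  fix a b assume ab: "a < n" "b < n" "a \<noteq> b"
  then have "q a < n" "q b < n" "q a \<noteq> q b"
    using permutes_in_image[OF assms(2)] permutes_inj[OF assms(2)] by (auto simp: inj_eq)
  then have "inverted p (q a) (q b) = (x (q a) \<noteq> (x (q b) \<noteq> k))"
    using assms(1) by (auto simp: cut_with_def)
  moreover have "inverted (p \<circ> q) a b = False"
    unfolding assms(3) by (simp add: inverted_def)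
  ultimately show "inverted q a b = (x (q a) \<noteq> (x (q b) \<noteq> k))"
    unfolding inverted_comp by argo
qed

lemma cut_with_id: "cut_with n (\<lambda>_. False) False id"
  by (auto simp: cut_with_def inverted_def)

lemma cut_with_cyclic_shift: "cut_with n (\<lambda>a. a = n - 1) False (cyclic_shift n)"
  by (auto simp: cut_with_def inverted_def cyclic_shift_def mod_Suc)

lemma cut_with_order_reversal: "cut_with n (\<lambda>_. False) True (order_reversal n)"
  by (auto simp: cut_with_def inverted_def order_reversal_def)

text \<open>
  Composition adds the constants \<open>k\<close> modulo 2, so \<open>K\<close> has to be closed under this addition.
  The choice \<open>{False}\<close> will give the cyclic group and \<open>UNIV\<close> the dihedral group.
\<close>

lemma subgroup_cut:
  assumes "False \<in> K" "\<And>k l. k \<in> K \<Longrightarrow> l \<in> K \<Longrightarrow> (k \<noteq> l) \<in> K"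
  shows "subgroup {p. p permutes {..<n} \<and> (\<exists>x. \<exists>k\<in>K. cut_with n x k p)} (perm_group n)"
    (is "subgroup ?H _")
proof
  interpret group "perm_group n" by (rule group_perm_group)
  show "?H \<subseteq> carrier (perm_group n)" by (auto simp: perm_group_def)
  show "\<one>\<^bsub>perm_group n\<^esub> \<in> ?H"
    using cut_with_id assms(1) by (auto simp: perm_group_def permutes_id)
  fix p assume p: "p \<in> ?H"
  then obtain x k where k: "k \<in> K" "cut_with n x k p" by blast
  have c: "p \<in> carrier (perm_group n)" using p by (simp add: perm_group_def)
  have q: "inv\<^bsub>perm_group n\<^esub> p permutes {..<n}"
    using inv_closed[OF c] by (simp add: perm_group_def)
  have "p \<circ> inv\<^bsub>perm_group n\<^esub> p = id"
    using r_inv[OF c] by (simp add: perm_group_def)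
  from cut_with_right_inverse[OF k(2) q this] q k(1)
  show "inv\<^bsub>perm_group n\<^esub> p \<in> ?H" by blast
  fix q assume q: "q \<in> ?H"
  then obtain y l where "l \<in> K" "cut_with n y l q" by blast
  then have "\<exists>x. \<exists>k\<in>K. cut_with n x k (p \<circ> q)"
    using cut_with_comp[OF k(2), of y l q] q k(1) assms(2) by blast
  then show "p \<otimes>\<^bsub>perm_group n\<^esub> q \<in> ?H"
    using p q by (auto simp: perm_group_def intro: permutes_compose)
qed

lemma permutes_without_inversions:
  assumes "p permutes {..<n}" "\<And>a b. a < n \<Longrightarrow> b < n \<Longrightarrow> a \<noteq> b \<Longrightarrow> \<not> inverted p a b"
  shows "p = id"
proof (rule permutes_natset_ge[OF assms(1)], rule ballI)
  show "a \<le> p a" if "a \<in> {..<n}" for a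
    using that
  proof (induction a)
    case (Suc a)
    then have "p a < p (Suc a)" using assms(2)[of a "Suc a"] by (auto simp: inverted_def)
    then show ?case using Suc by auto
  qed simp
qed

lemma funpow_cyclic_shift: "a < n \<Longrightarrow> (cyclic_shift n ^^ j) a = (a + j) mod n"
  by (induction j) (auto simp: cyclic_shift_def mod_Suc_eq)

lemma funpow_cyclic_shift_self: "cyclic_shift n ^^ n = id"
proof
  fix a show "(cyclic_shift n ^^ n) a = id a"
  proof (cases "a < n")
    case False
    have "(cyclic_shift n ^^ j) a = a" for j
      using False by (induction j) (auto simp: cyclic_shift_def)
    then show ?thesis by simp
  qed (simp add: funpow_cyclic_shift)
qed

lemma funpow_cyclic_shift_cut: "\<exists>x. cut_with n x False (cyclic_shift n ^^ j)"
proof (induction j)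
  case 0
  then show ?case using cut_with_id by (auto simp: id_def)
next
  case (Suc j)
  then obtain x where "cut_with n x False (cyclic_shift n ^^ j)" by blast
  from cut_with_comp[OF cut_with_cyclic_shift this permutes_funpow[OF cyclic_shift_permutes]]
  show ?case by (auto simp only: funpow.simps simp_thms)
qed

text \<open>
  Nothing is inverted with the fixed point \<open>0\<close>, so all \<open>x b\<close> equal \<open>x 0\<close> and no pair is
  inverted.
\<close>

lemma cut_fixing_zero:
  assumes "p permutes {..<n}" "cut_with n x False p" "p 0 = 0"
  shows "p = id"
proof (rule permutes_without_inversions[OF assms(1)])
  have "x b = x 0" if b: "b < n" for b
  proof (cases "b = 0")
    case False
    then have "p b \<noteq> 0" using assms(1,3) permutes_inj by (metis inj_eq)
    then have "\<not> inverted p 0 b" using False assms(3) by (simp add: inverted_def)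
    then show ?thesis using assms(2) False b by (auto simp: cut_with_def)
  qed simp
  then show "\<not> inverted p a b" if "a < n" "b < n" "a \<noteq> b" for a b
    using assms(2) that unfolding cut_with_def by metis
qed

text \<open>
  A rotation takes the image of \<open>0\<close> back to \<open>0\<close> without leaving the class of permutations with
  \<open>k = 0\<close>, so the preceding lemma applies to the composition.
\<close>

lemma cut_imp_funpow_cyclic_shift:
  assumes "n > 0" "p permutes {..<n}" "cut_with n x False p"
  shows "p = cyclic_shift n ^^ p 0"
proof -
  let ?s = "cyclic_shift n"
  have p0: "p 0 < n" using permutes_in_image[OF assms(2), of 0] assms(1) by simp
  let ?q = "(?s ^^ (n - p 0)) \<circ> p"
  have q: "?q permutes {..<n}"
    using assms(2) permutes_funpow[OF cyclic_shift_permutes] by (intro permutes_compose)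
  obtain y where "cut_with n y False (?s ^^ (n - p 0))" using funpow_cyclic_shift_cut by blast
  from cut_with_comp[OF this assms(3,2)]
  obtain z where z: "cut_with n z False ?q" by auto
  have "?q 0 = 0" using p0 by (simp add: funpow_cyclic_shift)
  then have "?q = id" using cut_fixing_zero[OF q z] by simp
  have "p = (?s ^^ n) \<circ> p" by (simp add: funpow_cyclic_shift_self)
  also have "?s ^^ n = ?s ^^ p 0 \<circ> ?s ^^ (n - p 0)"
    using p0 by (simp flip: funpow_add)
  finally have "p = ?s ^^ p 0 \<circ> ?q" unfolding comp_assoc .
  then show ?thesis unfolding \<open>?q = id\<close> comp_id .
qed

section \<open>The cyclic and the dihedral group\<close>

lemma mult_perm_group: "p \<otimes>\<^bsub>perm_group n\<^esub> q = p \<circ> q"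
  by (simp add: perm_group_def)

lemma funpow_in_generate:
  assumes "s \<in> H" shows "s ^^ j \<in> generate (perm_group n) H"
proof (induction j)
  case 0
  then show ?case using generate.one[of "perm_group n" H] by (simp add: perm_group_def id_def)
next
  case (Suc j)
  then show ?case
    using generate.eng[OF generate.incl[OF assms] Suc] by (simp only: mult_perm_group funpow.simps)
qed

lemma cyclic_perms_eq:
  assumes "n > 0"
  shows "cyclic_perms n = {p. p permutes {..<n} \<and> (\<exists>x. cut_with n x False p)}" (is "_ = ?H")
proof
  have "subgroup ?H (perm_group n)" using subgroup_cut[of "{False}" n] by simp
  then show "cyclic_perms n \<subseteq> ?H"
    unfolding cyclic_perms_def using cut_with_cyclic_shift cyclic_shift_permutes
    by (intro group.generate_subgroup_incl[OF group_perm_group]) auto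
  show "?H \<subseteq> cyclic_perms n"
  proof clarify
    fix p x assume "p permutes {..<n}" "cut_with n x False p"
    then have "p = cyclic_shift n ^^ p 0" by (rule cut_imp_funpow_cyclic_shift[OF assms])
    moreover have "cyclic_shift n ^^ p 0 \<in> cyclic_perms n"
      unfolding cyclic_perms_def by (rule funpow_in_generate) simp
    ultimately show "p \<in> cyclic_perms n" by metis
  qed
qed

lemma order_reversal_involution: "order_reversal n \<circ> order_reversal n = id"
  by (auto simp: order_reversal_def fun_eq_iff)

lemma order_reversal_comp_cut:
  assumes "p permutes {..<n}" "cut_with n x True p"
  shows "order_reversal n \<circ> p permutes {..<n}" "cut_with n x False (order_reversal n \<circ> p)"
  using permutes_compose[OF assms(1) order_reversal_permutes]
    cut_with_comp[OF cut_with_order_reversal assms(2,1)] by auto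

lemma order_reversal_comp_cancel: "order_reversal n \<circ> (order_reversal n \<circ> p) = p"
  by (simp add: order_reversal_involution flip: comp_assoc)

lemma dihedral_perms_eq:
  assumes "n > 0"
  shows "dihedral_perms n = {p. p permutes {..<n} \<and> (\<exists>x k. cut_with n x k p)}" (is "_ = ?H")
proof
  have "subgroup ?H (perm_group n)" using subgroup_cut[of UNIV n] by simp
  then show "dihedral_perms n \<subseteq> ?H"
    unfolding dihedral_perms_def
    using cut_with_cyclic_shift[of n] cyclic_shift_permutes
      cut_with_order_reversal[of n] order_reversal_permutes
    by (intro group.generate_subgroup_incl[OF group_perm_group]) blast+
  have rot: "q \<in> dihedral_perms n" if "q permutes {..<n}" "cut_with n x False q" for q x
  proof -
    have "cyclic_shift n ^^ q 0 \<in> dihedral_perms n"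
      unfolding dihedral_perms_def by (rule funpow_in_generate) simp
    then show ?thesis using cut_imp_funpow_cyclic_shift[OF assms that] by metis
  qed
  show "?H \<subseteq> dihedral_perms n"
  proof clarify
    fix p x k assume p: "p permutes {..<n}" "cut_with n x k p"
    show "p \<in> dihedral_perms n"
    proof (cases k)
      case True
      then have "order_reversal n \<circ> p \<in> dihedral_perms n"
        using order_reversal_comp_cut[OF p(1)] p(2) by (intro rot) auto
      then have "order_reversal n \<circ> (order_reversal n \<circ> p) \<in> dihedral_perms n"
        unfolding dihedral_perms_def
        by (subst mult_perm_group[of n, symmetric], intro generate.eng[OF generate.incl]) simp_all
      then show ?thesis by (simp only: order_reversal_comp_cancel)
    next
      case False
      then show ?thesis using rot p by simp
    qed
  qed
qed

section \<open>The classification\<close>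

lemma Gamma_even_subset:
  assumes "2 \<le> t" "t + 2 \<le> n" "even t" "p \<in> Gamma n t"
  shows "p = id \<or> p = order_reversal n \<and> even (t choose 2)"
proof -
  have p: "p permutes {..<n}" using assms(4) by (simp add: Gamma_def)
  have tn: "t < n" using assms by simp
  obtain x k where cut: "cut_with n x k p" using Gamma_cut_inversions[OF assms(1,2,4)] .
  have x: "x a = x b" if "a < n" "b < n" for a b
    by (rule Gamma_even_cut_constant[OF assms(1) tn assms(3,4) cut that])
  have no_inversions: "q = id" if "q permutes {..<n}" "cut_with n x False q" for q
  proof (rule permutes_without_inversions[OF that(1)])
    show "\<not> inverted q a b" if "a < n" "b < n" "a \<noteq> b" for a b
      using x[of a b] that \<open>cut_with n x False q\<close> by (simp add: cut_with_def)
  qed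
  show ?thesis
  proof (cases k)
    case True
    then have k: "cut_with n x True p" using cut by simp
    have "order_reversal n \<circ> p = id"
      by (rule no_inversions[OF order_reversal_comp_cut[OF p k]])
    then have "p = order_reversal n" using order_reversal_comp_cancel[of n p] by simp
    then show ?thesis using Gamma_cut_complement_even_choose[OF assms(1) tn assms(4) k] by simp
  next
    case False
    then show ?thesis using no_inversions[OF p] cut by simp
  qed
qed

theorem theorem6:
  fixes n t :: nat
  assumes "n > 0" and "2 \<le> t" and "t + 2 \<le> n"
  shows "([t = 2] (mod 4) \<longrightarrow> Gamma n t = {id})
       \<and> ([t = 3] (mod 4) \<longrightarrow> Gamma n t = cyclic_perms n)
       \<and> ([t = 0] (mod 4) \<longrightarrow> Gamma n t = {order_reversal n, id})
       \<and> ([t = 1] (mod 4) \<longrightarrow> Gamma n t = dihedral_perms n)"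
proof -
  have tn: "t < n" using assms by simp
  have id: "id \<in> Gamma n t"
    using Gamma_of_cut[OF cut_with_id permutes_id] by simp
  have rev: "order_reversal n \<in> Gamma n t" if "even (t choose 2)"
    using Gamma_of_cut[OF cut_with_order_reversal order_reversal_permutes] that by simp
  have sub: "p permutes {..<n} \<and> (\<exists>x k. cut_with n x k p \<and> (k \<longrightarrow> even (t choose 2)))"
    if p: "p \<in> Gamma n t" for p
  proof -
    obtain x k where cut: "cut_with n x k p" using Gamma_cut_inversions[OF assms(2,3) p] .
    have "k \<longrightarrow> even (t choose 2)"
      using cut Gamma_cut_complement_even_choose[OF assms(2) tn p] by (cases k) simp_all
    then show ?thesis using cut p unfolding Gamma_def by blast
  qed
  have odd: "Gamma n t =
      {p. p permutes {..<n} \<and> (\<exists>x k. cut_with n x k p \<and> (k \<longrightarrow> even (t choose 2)))}"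
    if "odd t"
  proof (intro equalityI subsetI CollectI)
    fix p
    assume "p \<in> {p. p permutes {..<n} \<and>
      (\<exists>x k. cut_with n x k p \<and> (k \<longrightarrow> even (t choose 2)))}"
    then obtain x k where "p permutes {..<n}" "cut_with n x k p" "k \<longrightarrow> even (t choose 2)"
      by blast
    then show "p \<in> Gamma n t"
      using \<open>odd t\<close> by (intro Gamma_of_cut[of n x k]) auto
  qed (rule sub)
  have "Gamma n t = {id}" if t: "t mod 4 = 2"
  proof -
    have "even t" using t by presburger
    moreover have "odd (t choose 2)" using t by (simp add: even_choose_two_iff)
    ultimately show ?thesis using Gamma_even_subset[OF assms(2,3)] id by blast
  qed
  moreover have "Gamma n t = cyclic_perms n" if t: "t mod 4 = 3"
  proof -
    have "odd t" using t by presburger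
    moreover have "odd (t choose 2)" using t by (simp add: even_choose_two_iff)
    ultimately show ?thesis
      unfolding cyclic_perms_eq[OF assms(1)] odd[OF \<open>odd t\<close>] by (simp add: ex_bool_eq)
  qed
  moreover have "Gamma n t = {order_reversal n, id}" if t: "t mod 4 = 0"
  proof -
    have "even t" using t by presburger
    moreover have "even (t choose 2)" using t by (simp add: even_choose_two_iff)
    ultimately show ?thesis
      using id rev by (auto dest: Gamma_even_subset[OF assms(2,3) \<open>even t\<close>])
  qed
  moreover have "Gamma n t = dihedral_perms n" if t: "t mod 4 = 1"
  proof -
    have "odd t" using t by presburger
    moreover have "even (t choose 2)" using t by (simp add: even_choose_two_iff)
    ultimately show ?thesis
      unfolding dihedral_perms_eq[OF assms(1)] odd[OF \<open>odd t\<close>] by simp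
  qed
  ultimately show ?thesis by (simp add: cong_def)
qed

end
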